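(* Let $\zeta$ be a primitive aperiodic substitution on $\mathcal A$ and let $v$ be a return word starting with $c\in\mathcal A$ such that $vc$ occurs as a subword in $\zeta(b)$ for every $b\in\mathcal A$. Then there exist $c_1\in(0,1)$ and $C',C'',C_2>0$, depending only on the substitution $\zeta$, such that: (i) for all $a,b\in\mathcal A$, $n\in\mathbb N$, and $\omega\in[0,1)$, $$|\Phi_a(\zeta^n(b),\omega)|\le C'|\zeta^n(b)|\prod_{k=0}^{n-1}\Bigl(1-c_1\bigl\|\omega|\zeta^k(v)|\bigr\|^2\Bigr);$$ (ii) for all $N\in\mathbb N$, $\omega\in[0,1)$, and $a\in\mathcal A$, $$|S_N^x(\mathbf 1_{[a]},\omega)|\le C''N\prod_{k=0}^{\lfloor\log_\theta N-C_2\rfloor}\Bigl(1-c_1\bigl\|\omega|\zeta^k(v)|\bigr\|^2\Bigr)\quad\text{for all } x\in X_\zeta .$$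
   Context: Let $\mathcal A=\{1,\dots,m\}$, $m\ge2$, and let $\mathcal A^+$ be the set of nonempty finite words over $\mathcal A$. A substitution is a map $\zeta:\mathcal A\to\mathcal A^+$, extended to words by concatenation. The substitution matrix $\mathsf S$ has $\mathsf S(i,j)$ = number of symbols $i$ in $\zeta(j)$; $\zeta$ is primitive if some power of $\mathsf S$ is entrywise strictly positive; $\theta$ is the Perron-Frobenius eigenvalue of $\mathsf S$. $X_\zeta\subset\mathcal A^{\mathbb Z}$ is the set of bi-infinite sequences all of whose finite subwords occur as subwords of $\zeta^n(a)$ for some $a,n$; $T_\zeta$ is the left shift on $X_\zeta$; aperiodic means $X_\zeta$ is infinite. $|u|$ is the length of a word $u$, and $[a]=\{x\in X_\zeta:x_0=a\}$. A word $v$ is a return word if it starts with some letter $c$, contains no other occurrence of $c$, and $vc$ occurs as a subword of sequences in $X_\zeta$. For a word $u=u_0u_1\cdots u_{\ell-1}$, $\Phi_a(u,\omega)=\sum_{j:\,u_j=a}e^{-2\pi i\omega j}$. For $x\in X_\zeta$, $S_N^x(f,\omega)=\sum_{n=0}^{N-1}e^{-2\pi in\omega}f(T_\zeta^nx)$. For real $y$, $\|y\|=\mathrm{dist}(y,\mathbb Z)$. An empty product equals $1$. *)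

theory Defs
  imports "HOL-Analysis.Analysis" "HOL-Library.Sublist"
begin

text \<open>
  The alphabet is a finite type \<open>'a\<close>, words are lists over it, and bi-infinite sequences are
  functions \<open>int \<Rightarrow> 'a\<close>. Occurrence of a word as a (contiguous) subword is \<open>sublist\<close>.
\<close>

definition substitution :: "('a \<Rightarrow> 'a list) \<Rightarrow> bool" where
  "substitution \<zeta> \<longleftrightarrow> (\<forall>a. \<zeta> a \<noteq> [])"

definition subst_word :: "('a \<Rightarrow> 'a list) \<Rightarrow> 'a list \<Rightarrow> 'a list" where
  "subst_word \<zeta> u = concat (map \<zeta> u)"

definition subst_pow :: "('a \<Rightarrow> 'a list) \<Rightarrow> nat \<Rightarrow> 'a list \<Rightarrow> 'a list" where
  "subst_pow \<zeta> n = subst_word \<zeta> ^^ n"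

definition subst_matrix :: "('a::finite \<Rightarrow> 'a list) \<Rightarrow> real ^ 'a ^ 'a" where
  "subst_matrix \<zeta> = (\<chi> i j. real (count_list (\<zeta> j) i))"

text \<open>Powers with respect to the matrix product; the type-class power \<open>^\<close> on vectors
  would be entrywise.\<close>

definition mat_pow :: "real ^ 'n ^ 'n \<Rightarrow> nat \<Rightarrow> real ^ 'n ^ 'n" where
  "mat_pow A k = (((**) A) ^^ k) (mat 1)"

definition primitive_subst :: "('a::finite \<Rightarrow> 'a list) \<Rightarrow> bool" where
  "primitive_subst \<zeta> \<longleftrightarrow> (\<exists>k\<ge>1. \<forall>i j. mat_pow (subst_matrix \<zeta>) k $ i $ j > 0)"

definition complex_eigenvalue :: "real ^ 'n ^ 'n \<Rightarrow> complex \<Rightarrow> bool" where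
  "complex_eigenvalue A \<mu> \<longleftrightarrow>
     (\<exists>x. x \<noteq> 0 \<and> (\<chi> i j. complex_of_real (A $ i $ j)) *v x = \<mu> *s x)"

text \<open>The Perron--Frobenius eigenvalue: the positive real eigenvalue that strictly exceeds all
  other (complex) eigenvalues in modulus. It exists for primitive nonnegative matrices.\<close>

definition pf_eigenvalue :: "real ^ 'n ^ 'n \<Rightarrow> real" where
  "pf_eigenvalue A =
     (THE r. r > 0 \<and> complex_eigenvalue A (complex_of_real r) \<and>
        (\<forall>\<mu>. complex_eigenvalue A \<mu> \<and> \<mu> \<noteq> complex_of_real r \<longrightarrow> cmod \<mu> < r))"

text \<open>The finite subwords of \<open>x\<close> are the words \<open>map x [i..j]\<close> (empty if \<open>j < i\<close>).\<close>

definition subst_space :: "('a \<Rightarrow> 'a list) \<Rightarrow> (int \<Rightarrow> 'a) set" where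
  "subst_space \<zeta> = {x. \<forall>i j. \<exists>a n. sublist (map x [i..j]) (subst_pow \<zeta> n [a])}"

definition shift :: "(int \<Rightarrow> 'a) \<Rightarrow> (int \<Rightarrow> 'a)" where
  "shift x = (\<lambda>k. x (k + 1))"

definition aperiodic_subst :: "('a \<Rightarrow> 'a list) \<Rightarrow> bool" where
  "aperiodic_subst \<zeta> \<longleftrightarrow> infinite (subst_space \<zeta>)"

definition cylinder :: "('a \<Rightarrow> 'a list) \<Rightarrow> 'a \<Rightarrow> (int \<Rightarrow> 'a) set" where
  "cylinder \<zeta> a = {x \<in> subst_space \<zeta>. x 0 = a}"

definition return_word :: "('a \<Rightarrow> 'a list) \<Rightarrow> 'a \<Rightarrow> 'a list \<Rightarrow> bool" where
  "return_word \<zeta> c v \<longleftrightarrow>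
     (\<exists>w. v = c # w \<and> c \<notin> set w) \<and>
     (\<exists>x \<in> subst_space \<zeta>. \<exists>i j. map x [i..j] = v @ [c])"

definition Phi :: "'a \<Rightarrow> 'a list \<Rightarrow> real \<Rightarrow> complex" where
  "Phi a u \<omega> = (\<Sum>j | j < length u \<and> u ! j = a.
     exp (- 2 * complex_of_real pi * \<i> * complex_of_real \<omega> * of_nat j))"

definition twisted_sum ::
    "((int \<Rightarrow> 'a) \<Rightarrow> complex) \<Rightarrow> (int \<Rightarrow> 'a) \<Rightarrow> nat \<Rightarrow> real \<Rightarrow> complex" where
  "twisted_sum f x N \<omega> = (\<Sum>n<N.
     exp (- 2 * complex_of_real pi * \<i> * of_nat n * complex_of_real \<omega>) * f ((shift ^^ n) x))"

definition dist_int :: "real \<Rightarrow> real" where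
  "dist_int y = infdist y \<int>"

end

theory Submission
  imports Defs
begin

text \<open>
  Let \<open>l\<close> be a positive left Perron eigenvector of the substitution matrix, so that the
  \<open>l\<close>-weight of \<open>\<zeta>\<^sup>n u\<close> is \<open>\<theta>\<^sup>n\<close> times that of \<open>u\<close>. Expanding \<open>\<zeta>\<^sup>n\<^sup>+\<^sup>1 b = \<zeta>\<^sup>n (\<zeta> b)\<close>
  letter by letter, two copies of \<open>\<zeta>\<^sup>n c\<close> carry phases that differ by the rotation through
  \<open>\<omega> \<bar>\<zeta>\<^sup>n v\<bar>\<close>, and the resulting loss is a fixed fraction of the whole weight; this gives (i) by
  induction on \<open>n\<close>. For (ii), a window of length \<open>N\<close> is the difference of two prefixes of some
  \<open>\<zeta>\<^sup>n(b\<^sub>1 b\<^sub>2)\<close> with \<open>\<theta>\<^sup>n\<close> comparable to \<open>N\<close>, and a prefix splits into boundedly many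
  words \<open>\<zeta>\<^sup>k b\<close> for each \<open>k \<le> n\<close>. Since \<open>\<zeta> c\<close> contains \<open>c\<close> twice, \<open>\<theta> \<ge> 2\<close>, which
  outweighs every single factor of the product, so the bounds from (i) grow geometrically in \<open>k\<close>.
\<close>

section \<open>Perron--Frobenius theory for primitive matrices\<close>

text \<open>Brouwer's theorem applied to the normalised map \<open>x v* A\<close> on the standard
  simplex gives a nonnegative eigenvector; the positive power \<open>k\<close> then forces all its
  entries to be positive.\<close>

lemma exists_pos_left_eigenvector:
  fixes A :: "real ^ 'n ^ 'n"
  assumes nonneg: "\<And>i j. 0 \<le> A $ i $ j"
    and pos: "\<And>i j. 0 < mat_pow A k $ i $ j" and "k \<ge> 1"
  obtains l \<theta> where "\<theta> > 0" "\<And>i. l $ i > 0" "l v* A = \<theta> *\<^sub>R l"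
proof -
  obtain m where m: "k = Suc m"
    using \<open>k \<ge> 1\<close> by (cases k) auto
  define S where "S = {x :: real ^ 'n. (\<forall>i. 0 \<le> x $ i) \<and> (\<Sum>i\<in>UNIV. x $ i) = 1}"
  define s where "s = (\<lambda>x :: real ^ 'n. \<Sum>j\<in>UNIV. (x v* A) $ j)"
  define f where "f = (\<lambda>x. (1 / s x) *\<^sub>R (x v* A))"
  have pow: "x v* mat_pow A k = (x v* A) v* mat_pow A m" for x
    by (simp add: m mat_pow_def vector_matrix_mul_assoc)
  have pos_pow: "0 < (x v* mat_pow A k) $ j" if x: "x \<in> S" for x j
  proof -
    obtain i where "x $ i \<noteq> 0"
      using x by (force simp: S_def)
    then have "0 < x $ i"
      using x by (auto simp: S_def order_less_le)
    then have "0 < (\<Sum>i\<in>UNIV. mat_pow A k $ i $ j * x $ i)"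
      using x pos by (intro sum_pos2[of _ i]) (auto simp: S_def less_imp_le)
    then show ?thesis
      by (simp add: vector_matrix_mult_def mult.commute)
  qed
  have nonneg_mult: "0 \<le> (x v* A) $ j" if "x \<in> S" for x j
    using that nonneg by (auto simp: vector_matrix_mult_def S_def intro!: sum_nonneg)
  \<comment> \<open>The normalisation is legitimate: were \<open>x v* A\<close> zero, the positive
    vector \<open>x v* mat_pow A k\<close> would be zero too.\<close>
  have s_pos: "s x > 0" if x: "x \<in> S" for x
  proof -
    have "x v* A \<noteq> 0"
      using pos_pow[OF x] by (auto simp: pow)
    then obtain j where "(x v* A) $ j \<noteq> 0"
      by (auto simp: vec_eq_iff)
    then show ?thesis
      unfolding s_def using nonneg_mult[OF x]
      by (intro sum_pos2[of _ j]) (auto simp: order_less_le)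
  qed
  have cont: "continuous_on S (\<lambda>x. x v* A)"
    unfolding vector_matrix_mult_def by (intro continuous_intros)
  have f_cont: "continuous_on S f"
    unfolding f_def s_def
    by (intro continuous_intros cont) (use s_pos in \<open>force simp: s_def\<close>)
  have f_in: "f x \<in> S" if "x \<in> S" for x
    using that s_pos[OF that] nonneg_mult[OF that]
    by (simp add: S_def f_def s_def flip: sum_divide_distrib)
  have "closed S"
    unfolding S_def Collect_conj_eq Collect_all_eq
    by (intro closed_Int closed_INT ballI closed_Collect_le closed_Collect_eq continuous_intros)
  moreover have "bounded S"
    unfolding bounded_iff
  proof (intro exI ballI)
    fix x assume "x \<in> S"
    then show "norm x \<le> 1"
      using norm_le_l1_cart[of x] by (simp add: S_def)
  qed
  ultimately have "compact S"
    by (simp add: compact_eq_bounded_closed)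
  moreover have "convex S"
    unfolding convex_def S_def
    by (auto simp: sum.distrib simp flip: sum_distrib_left)
  moreover have "axis undefined 1 \<in> S"
    by (auto simp: S_def axis_def)
  then have "S \<noteq> {}" by auto
  ultimately obtain l where l: "l \<in> S" "f l = l"
    using brouwer[of S f] f_cont f_in by blast
  have eig: "l v* A = s l *\<^sub>R l"
  proof -
    have "s l *\<^sub>R f l = l v* A"
      using s_pos[OF l(1)] by (simp add: f_def)
    then show ?thesis using l(2) by simp
  qed
  have "l v* mat_pow A n = s l ^ n *\<^sub>R l" for n
  proof (induction n)
    case (Suc n)
    have "l v* mat_pow A (Suc n) = (l v* A) v* mat_pow A n"
      by (simp add: mat_pow_def vector_matrix_mul_assoc)
    then show ?case
      by (simp add: eig scaleR_vector_matrix_assoc Suc)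
  qed (simp add: mat_pow_def)
  then have "0 < s l ^ k * l $ i" for i
    using pos_pow[OF l(1), of i] by simp
  then have "l $ i > 0" for i
    using s_pos[OF l(1)] by (simp add: zero_less_mult_iff)
  then show thesis
    using that s_pos[OF l(1)] eig by blast
qed

text \<open>A matrix and its transpose have the same determinant, so a left eigenvalue is also one
  for column vectors, the kind that \<open>complex_eigenvalue\<close> asks for.\<close>

lemma left_eigenvalue_imp_complex_eigenvalue:
  fixes A :: "real ^ 'n ^ 'n"
  assumes "l v* A = \<theta> *\<^sub>R l" "l \<noteq> 0"
  shows "complex_eigenvalue A (complex_of_real \<theta>)"
proof -
  let ?B = "A - mat \<theta>"
  have "transpose ?B *v l = 0"
    using assms(1)
    by (simp add: vec_eq_iff vector_matrix_mult_def mat_def right_diff_distrib sum_subtractf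
        if_distrib[of "\<lambda>y. _ * y"] mult.commute[of \<theta>] cong: if_cong)
  then have "det (transpose ?B) = 0"
    using assms(2) by (metis invertible_det_nz invertible_left_inverse matrix_left_invertible_ker)
  then have "det ?B = 0"
    by (simp only: det_transpose)
  then obtain x where x: "?B *v x = 0" "x \<noteq> 0"
    by (metis invertible_det_nz invertible_left_inverse matrix_left_invertible_ker)
  then have "(\<Sum>j\<in>UNIV. A $ i $ j * x $ j) = \<theta> * x $ i" for i
    by (simp add: vec_eq_iff matrix_vector_mult_def mat_def left_diff_distrib sum_subtractf
        if_distrib[of "\<lambda>x. x * _"] cong: if_cong)
  then have "(\<Sum>j\<in>UNIV. complex_of_real (A $ i $ j) * complex_of_real (x $ j)) = 
      complex_of_real \<theta> * complex_of_real (x $ i)" for i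
    by (metis (mono_tags, lifting) of_real_mult of_real_sum sum.cong)
  then show ?thesis
    unfolding complex_eigenvalue_def using x(2)
    by (intro exI[of _ "\<chi> i. complex_of_real (x $ i)"])
      (auto simp: vec_eq_iff matrix_vector_mult_def)
qed

text \<open>If \<open>\<mu> \<noteq> \<theta>\<close>, an eigenvector \<open>x\<close> for \<open>\<mu>\<close> is orthogonal to \<open>l\<close>, so subtracting from
  \<open>A\<^sup>k\<close> the rank-one matrix with all rows \<open>\<delta> l\<close> does not change its value at \<open>x\<close>
  but lowers the Perron eigenvalue \<open>\<theta>\<^sup>k\<close>; this gives the strict inequality.\<close>

lemma complex_eigenvalue_less:
  fixes A :: "real ^ 'n ^ 'n"
  assumes pos: "\<And>i j. 0 < mat_pow A k $ i $ j"
    and l: "\<And>i. l $ i > 0" "l v* A = \<theta> *\<^sub>R l" and "\<theta> > 0"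
    and \<mu>: "complex_eigenvalue A \<mu>" "\<mu> \<noteq> complex_of_real \<theta>"
  shows "cmod \<mu> < \<theta>"
proof -
  obtain x where x0: "x \<noteq> 0" and "(\<chi> i j. complex_of_real (A $ i $ j)) *v x = \<mu> *s x"
    using \<mu>(1) by (auto simp: complex_eigenvalue_def)
  then have x: "(\<Sum>j\<in>UNIV. complex_of_real (A $ i $ j) * x $ j) = \<mu> * x $ i" for i
    by (simp add: vec_eq_iff matrix_vector_mult_def)
  have lA: "(\<Sum>i\<in>UNIV. l $ i * A $ i $ j) = \<theta> * l $ j" for j
    using l(2) by (simp add: vec_eq_iff vector_matrix_mult_def mult.commute)
  define M where "M = mat_pow A k"
  have "(\<Sum>j\<in>UNIV. complex_of_real (mat_pow A n $ i $ j) * x $ j) = \<mu> ^ n * x $ i" for i n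
  proof (induction n arbitrary: i)
    case 0
    have "(\<Sum>j\<in>UNIV. complex_of_real (mat_pow A 0 $ i $ j) * x $ j)
        = (\<Sum>j\<in>UNIV. if j = i then x $ j else 0)"
      by (intro sum.cong) (auto simp: mat_pow_def mat_def)
    then show ?case by simp
  next
    case (Suc n)
    have "(\<Sum>j\<in>UNIV. complex_of_real (mat_pow A (Suc n) $ i $ j) * x $ j)
       = (\<Sum>j\<in>UNIV. \<Sum>h\<in>UNIV. complex_of_real (A $ i $ h) * (complex_of_real (mat_pow A n $ h $ j) * x $ j))"
      by (simp add: mat_pow_def matrix_matrix_mult_def sum_distrib_right mult.assoc)
    also have "\<dots> = (\<Sum>h\<in>UNIV. complex_of_real (A $ i $ h) * (\<Sum>j\<in>UNIV. complex_of_real (mat_pow A n $ h $ j) * x $ j))"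
      by (subst sum.swap) (simp add: sum_distrib_left)
    also have "\<dots> = \<mu> ^ n * (\<Sum>h\<in>UNIV. complex_of_real (A $ i $ h) * x $ h)"
      unfolding Suc sum_distrib_left by (simp add: mult_ac)
    finally show ?case unfolding x by simp
  qed
  then have Mx: "(\<Sum>j\<in>UNIV. complex_of_real (M $ i $ j) * x $ j) = \<mu> ^ k * x $ i" for i
    by (simp add: M_def)
  have "(\<Sum>i\<in>UNIV. l $ i * mat_pow A n $ i $ j) = \<theta> ^ n * l $ j" for n j
  proof (induction n arbitrary: j)
    case 0
    have "(\<Sum>i\<in>UNIV. l $ i * mat_pow A 0 $ i $ j) = (\<Sum>i\<in>UNIV. if i = j then l $ i else 0)"
      by (intro sum.cong) (auto simp: mat_pow_def mat_def)
    then show ?case by simp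
  next
    case (Suc n)
    have "(\<Sum>i\<in>UNIV. l $ i * mat_pow A (Suc n) $ i $ j)
       = (\<Sum>i\<in>UNIV. \<Sum>h\<in>UNIV. l $ i * A $ i $ h * mat_pow A n $ h $ j)"
      by (simp add: mat_pow_def matrix_matrix_mult_def sum_distrib_left mult.assoc)
    also have "\<dots> = (\<Sum>h\<in>UNIV. (\<Sum>i\<in>UNIV. l $ i * A $ i $ h) * mat_pow A n $ h $ j)"
      by (subst sum.swap) (simp add: sum_distrib_right)
    also have "\<dots> = \<theta> * (\<Sum>h\<in>UNIV. l $ h * mat_pow A n $ h $ j)"
      by (simp add: lA sum_distrib_left mult_ac)
    finally show ?case by (simp add: Suc mult_ac)
  qed
  then have lM: "(\<Sum>i\<in>UNIV. l $ i * M $ i $ j) = \<theta> ^ k * l $ j" for j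
    by (simp add: M_def)
  \<comment> \<open>Evaluating \<open>l A x\<close> from the left and from the right multiplies the
    same pairing by \<theta> and by \<mu>, which differ.\<close>
  have orth: "(\<Sum>i\<in>UNIV. complex_of_real (l $ i) * x $ i) = 0"
  proof -
    have "\<mu> * (\<Sum>i\<in>UNIV. complex_of_real (l $ i) * x $ i)
        = (\<Sum>i\<in>UNIV. complex_of_real (l $ i) * (\<Sum>j\<in>UNIV. complex_of_real (A $ i $ j) * x $ j))"
      unfolding x by (simp add: sum_distrib_left mult_ac)
    also have "\<dots> = (\<Sum>j\<in>UNIV. complex_of_real (\<Sum>i\<in>UNIV. l $ i * A $ i $ j) * x $ j)"
      unfolding sum_distrib_left
      by (subst sum.swap) (simp add: sum_distrib_left sum_distrib_right mult_ac)
    also have "\<dots> = complex_of_real \<theta> * (\<Sum>i\<in>UNIV. complex_of_real (l $ i) * x $ i)"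
      by (simp add: lA sum_distrib_left mult_ac del: of_real_sum)
    finally show ?thesis using \<mu>(2) by simp
  qed
  \<comment> \<open>The minimum of these ratios is the largest \<delta> for which \<delta> times
    \<open>l\<close> fits below every row of \<open>M\<close>.\<close>
  define R where "R = range (\<lambda>(i, j). M $ i $ j / l $ j)"
  define \<delta> where "\<delta> = Min R"
  have fin: "finite R" "R \<noteq> {}" by (auto simp: R_def)
  have "\<forall>r\<in>R. 0 < r"
    using pos l(1) by (auto simp: R_def M_def)
  then have "\<delta> > 0" using fin by (simp add: \<delta>_def)
  have \<delta>: "\<delta> * l $ j \<le> M $ i $ j" for i j
  proof -
    have "M $ i $ j / l $ j \<in> R"
      unfolding R_def by (rule image_eqI[of _ _ "(i, j)"]) auto
    then have "\<delta> \<le> M $ i $ j / l $ j"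
      using fin by (simp add: \<delta>_def)
    then show ?thesis using l(1)[of j] by (simp add: field_simps)
  qed
  let ?y = "\<Sum>i\<in>UNIV. l $ i * cmod (x $ i)"
  let ?t = "\<Sum>i\<in>UNIV. l $ i"
  have "cmod \<mu> ^ k * cmod (x $ i) \<le> (\<Sum>j\<in>UNIV. (M $ i $ j - \<delta> * l $ j) * cmod (x $ j))" for i
  proof -
    have "(\<Sum>j\<in>UNIV. complex_of_real (M $ i $ j - \<delta> * l $ j) * x $ j)
      = (\<Sum>j\<in>UNIV. complex_of_real (M $ i $ j) * x $ j)
        - complex_of_real \<delta> * (\<Sum>j\<in>UNIV. complex_of_real (l $ j) * x $ j)"
      by (simp add: left_diff_distrib sum_subtractf sum_distrib_left mult.assoc)
    then have "\<mu> ^ k * x $ i = (\<Sum>j\<in>UNIV. complex_of_real (M $ i $ j - \<delta> * l $ j) * x $ j)"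
      by (simp add: Mx orth)
    then have "cmod \<mu> ^ k * cmod (x $ i)
        = cmod (\<Sum>j\<in>UNIV. complex_of_real (M $ i $ j - \<delta> * l $ j) * x $ j)"
      by (metis norm_mult norm_power)
    also have "\<dots> \<le> (\<Sum>j\<in>UNIV. cmod (complex_of_real (M $ i $ j - \<delta> * l $ j) * x $ j))"
      by (rule norm_sum)
    also have "\<dots> = (\<Sum>j\<in>UNIV. (M $ i $ j - \<delta> * l $ j) * cmod (x $ j))"
      using \<delta> by (intro sum.cong) (simp_all only: norm_mult norm_of_real, simp)
    finally show ?thesis .
  qed
  \<comment> \<open>Pairing with \<open>l\<close> collapses the bounds for all rows into a single
    scalar inequality.\<close>
  then have "(\<Sum>i\<in>UNIV. l $ i * (cmod \<mu> ^ k * cmod (x $ i)))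
      \<le> (\<Sum>i\<in>UNIV. l $ i * (\<Sum>j\<in>UNIV. (M $ i $ j - \<delta> * l $ j) * cmod (x $ j)))"
    using l(1) by (intro sum_mono mult_left_mono) (auto simp: less_imp_le)
  also have "\<dots> = (\<Sum>j\<in>UNIV. (\<Sum>i\<in>UNIV. l $ i * (M $ i $ j - \<delta> * l $ j)) * cmod (x $ j))"
    unfolding sum_distrib_left by (subst sum.swap) (simp add: sum_distrib_right mult.assoc)
  also have "\<dots> = (\<Sum>j\<in>UNIV. (\<theta> ^ k * l $ j - \<delta> * ?t * l $ j) * cmod (x $ j))"
    by (simp add: right_diff_distrib sum_subtractf lM sum_distrib_left sum_distrib_right mult_ac)
  also have "\<dots> = (\<theta> ^ k - \<delta> * ?t) * ?y"
    unfolding sum_distrib_left[of "\<theta> ^ k - \<delta> * ?t"] by (simp only: algebra_simps)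
  also have "(\<Sum>i\<in>UNIV. l $ i * (cmod \<mu> ^ k * cmod (x $ i))) = cmod \<mu> ^ k * ?y"
    by (simp add: sum_distrib_left mult_ac)
  finally have le: "cmod \<mu> ^ k * ?y \<le> (\<theta> ^ k - \<delta> * ?t) * ?y" .
  obtain i where "x $ i \<noteq> 0"
    using x0 by (auto simp: vec_eq_iff)
  then have "?y > 0"
    using l(1) by (intro sum_pos2[of _ i]) (auto simp: less_imp_le)
  moreover have "\<delta> * ?t > 0"
    using \<open>\<delta> > 0\<close> l(1) by (intro mult_pos_pos sum_pos) auto
  ultimately have "cmod \<mu> ^ k < \<theta> ^ k"
    using le by (simp add: mult_le_cancel_right)
  then show ?thesis
    using \<open>\<theta> > 0\<close> by (meson less_imp_le power_less_imp_less_base)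
qed

text \<open>Uniqueness for the definite description: two distinct dominant eigenvalues would each be
  strictly smaller than the other.\<close>

lemma pf_eigenvalue_eqI:
  fixes A :: "real ^ 'n ^ 'n"
  assumes "\<And>i j. 0 < mat_pow A k $ i $ j" "\<And>i. l $ i > 0" "l v* A = \<theta> *\<^sub>R l" "\<theta> > 0"
  shows "pf_eigenvalue A = \<theta>"
  unfolding pf_eigenvalue_def
proof (rule the_equality)
  have "l \<noteq> 0" using assms(2) by (metis less_irrefl zero_index)
  then have ev: "complex_eigenvalue A (complex_of_real \<theta>)"
    using assms(3) by (rule left_eigenvalue_imp_complex_eigenvalue[rotated])
  have less: "cmod \<mu> < \<theta>" if "complex_eigenvalue A \<mu>" "\<mu> \<noteq> complex_of_real \<theta>" for \<mu>
    using complex_eigenvalue_less[OF assms that] .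
  show "\<theta> > 0 \<and> complex_eigenvalue A (complex_of_real \<theta>) \<and>
      (\<forall>\<mu>. complex_eigenvalue A \<mu> \<and> \<mu> \<noteq> complex_of_real \<theta> \<longrightarrow> cmod \<mu> < \<theta>)"
    using assms(4) ev less by blast
  fix r assume r: "r > 0 \<and> complex_eigenvalue A (complex_of_real r) \<and>
      (\<forall>\<mu>. complex_eigenvalue A \<mu> \<and> \<mu> \<noteq> complex_of_real r \<longrightarrow> cmod \<mu> < r)"
  show "r = \<theta>"
  proof (rule ccontr)
    assume "r \<noteq> \<theta>"
    then have "cmod (complex_of_real r) < \<theta>" "cmod (complex_of_real \<theta>) < r"
      using r ev less[of "complex_of_real r"] by auto
    then show False using r assms(4) by simp
  qed
qed

section \<open>Exponential sums over words\<close>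

lemma dist_int_nonneg: "0 \<le> dist_int y"
  by (simp add: dist_int_def infdist_nonneg)

lemma dist_int_le_round: "dist_int y \<le> \<bar>y - of_int (round y)\<bar>"
  unfolding dist_int_def dist_real_def[symmetric] by (rule infdist_le) auto

lemma dist_int_le_half: "dist_int y \<le> 1 / 2"
  using dist_int_le_round[of y] of_int_round_abs_le[of y] by linarith

lemma sin_ge_half:
  fixes x :: real
  assumes "0 \<le> x" "x \<le> pi / 3"
  shows "x / 2 \<le> sin x"
proof -
  have "sin 0 - 0 / 2 \<le> sin x - x / 2"
  proof (rule DERIV_nonneg_imp_nondecreasing[OF assms(1)])
    fix y assume y: "0 \<le> y" "y \<le> x"
    then have "cos (pi / 3) \<le> cos y"
      using assms by (intro cos_monotone_0_pi_le) auto
    then show "\<exists>d. ((\<lambda>x. sin x - x / 2) has_real_derivative d) (at y) \<and> 0 \<le> d"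
      by (intro exI[of _ "cos y - 1 / 2"] conjI)
        (auto intro!: derivative_eq_intros simp: cos_60)
  qed
  then show ?thesis by simp
qed

text \<open>With \<open>s\<close> the signed distance from \<open>y\<close> to a nearest integer,
  the modulus is \<open>2 * \<bar>cos (pi * s)\<bar>\<close>. Half-angle formula,
  \<open>sin_ge_half\<close> and \<open>pi > 3\<close> bound the cosine by
  \<open>1 - 9/8 * s\<^sup>2\<close>, which is more than needed.\<close>

lemma cmod_one_plus_exp_le:
  "cmod (1 + exp (- 2 * complex_of_real pi * \<i> * complex_of_real y)) \<le> 2 - 2 * (dist_int y)\<^sup>2"
proof -
  define s where "s = y - of_int (round y)"
  have s: "\<bar>s\<bar> \<le> 1 / 2"
    using of_int_round_abs_le[of y] by (simp add: s_def abs_minus_commute)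
  have eq: "- 2 * complex_of_real pi * \<i> * complex_of_real y
      = - 2 * complex_of_real pi * \<i> * complex_of_real s + complex_of_real (2 * real_of_int (- round y) * pi) * \<i>"
    by (simp add: s_def algebra_simps)
  have "exp (complex_of_real (2 * real_of_int (- round y) * pi) * \<i>) = 1"
    by (rule exp_integer_2pi) simp
  then have "exp (- 2 * complex_of_real pi * \<i> * complex_of_real y)
      = exp (- 2 * complex_of_real pi * \<i> * complex_of_real s)"
    unfolding eq exp_add by (simp only: mult_1_right)
  also have "\<dots> = cis (- (2 * pi * s))"
    by (simp add: cis_conv_exp mult_ac)
  also have "1 + cis (- (2 * pi * s)) = cis (- (pi * s)) * complex_of_real (2 * cos (pi * s))"
    using cos_double_cos[of "pi * s"] sin_double[of "pi * s"]
    by (simp add: complex_eq_iff power2_eq_square mult_ac)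
  finally have *: "cmod (1 + exp (- 2 * complex_of_real pi * \<i> * complex_of_real y)) = 2 * \<bar>cos (pi * s)\<bar>"
    by (simp add: norm_mult)
  have "pi * \<bar>s\<bar> / 2 \<le> pi / 3"
    using mult_left_mono[OF s, of pi] pi_gt_zero by simp
  then have "pi * \<bar>s\<bar> / 2 / 2 \<le> sin (pi * \<bar>s\<bar> / 2)"
    by (intro sin_ge_half) auto
  moreover have "3 * \<bar>s\<bar> \<le> pi * \<bar>s\<bar>"
    using pi_gt3 by (intro mult_right_mono) auto
  ultimately have "3 / 4 * \<bar>s\<bar> \<le> sin (pi * \<bar>s\<bar> / 2)"
    by linarith
  then have "(3 / 4 * \<bar>s\<bar>)\<^sup>2 \<le> (sin (pi * \<bar>s\<bar> / 2))\<^sup>2"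
    by (intro power_mono) auto
  then have "9 / 16 * s\<^sup>2 \<le> (sin (pi * \<bar>s\<bar> / 2))\<^sup>2"
    by (simp add: power_mult_distrib power2_eq_square)
  moreover have "cos (pi * \<bar>s\<bar>) = 1 - 2 * (sin (pi * \<bar>s\<bar> / 2))\<^sup>2"
    using cos_double_sin[of "pi * \<bar>s\<bar> / 2"] by simp
  ultimately have "cos (pi * \<bar>s\<bar>) \<le> 1 - s\<^sup>2"
    using zero_le_power2[of s] by linarith
  moreover have "0 \<le> cos (pi * \<bar>s\<bar>)"
  proof (rule cos_ge_zero)
    have "0 \<le> pi * \<bar>s\<bar>" by simp
    then show "- (pi / 2) \<le> pi * \<bar>s\<bar>" using pi_gt_zero by linarith
    show "pi * \<bar>s\<bar> \<le> pi / 2" using mult_left_mono[OF s, of pi] by simp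
  qed
  moreover have "cos (pi * \<bar>s\<bar>) = cos (pi * s)"
    by (cases "s \<ge> 0") auto
  moreover have "(dist_int y)\<^sup>2 \<le> s\<^sup>2"
    using power_mono[OF dist_int_le_round dist_int_nonneg, of y 2] by (simp add: s_def)
  ultimately show ?thesis
    unfolding * by linarith
qed

definition phase :: "real \<Rightarrow> nat \<Rightarrow> complex" where
  "phase \<omega> n = exp (- 2 * complex_of_real pi * \<i> * complex_of_real \<omega> * of_nat n)"

lemma phase_add: "phase \<omega> (m + n) = phase \<omega> m * phase \<omega> n"
  unfolding phase_def of_nat_add distrib_left by (rule exp_add)

lemma norm_phase [simp]: "cmod (phase \<omega> n) = 1"
  by (simp add: phase_def norm_exp_eq_Re)

lemma Phi_eq_sum: "Phi a u \<omega> = (\<Sum>j<length u. if u ! j = a then phase \<omega> j else 0)"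
  unfolding Phi_def phase_def by (simp add: sum.inter_filter[symmetric] lessThan_def)

lemma Phi_Nil [simp]: "Phi a [] \<omega> = 0"
  by (simp add: Phi_eq_sum)

lemma cmod_Phi_letter_le: "cmod (Phi a [b] \<omega>) \<le> 1"
proof -
  have "Phi a [b] \<omega> = (if b = a then phase \<omega> 0 else 0)"
    by (simp add: Phi_eq_sum)
  then show ?thesis by simp
qed

lemma Phi_append: "Phi a (s @ t) \<omega> = Phi a s \<omega> + phase \<omega> (length s) * Phi a t \<omega>"
proof (induction t rule: rev_induct)
  case (snoc x t)
  have snoc': "Phi a (u @ [x]) \<omega> = Phi a u \<omega> + (if x = a then phase \<omega> (length u) else 0)" for u
    by (simp add: Phi_eq_sum nth_append)
  show ?case
    using snoc snoc'[of "s @ t"] snoc'[of t] by (simp add: phase_add distrib_left add.assoc)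
qed simp

lemma cmod_Phi_append_le: "cmod (Phi a (s @ t) \<omega>) \<le> cmod (Phi a s \<omega>) + cmod (Phi a t \<omega>)"
  unfolding Phi_append by (metis norm_triangle_ineq norm_mult norm_phase mult_1)

text \<open>Up to a phase, the sum over a subword is the difference of the sums over two prefixes,
  whence the factor 2.\<close>

lemma cmod_Phi_sublist_le:
  assumes "sublist s t" and "\<And>u. prefix u t \<Longrightarrow> cmod (Phi a u \<omega>) \<le> K"
  shows "cmod (Phi a s \<omega>) \<le> 2 * K"
proof -
  obtain p q where t: "t = p @ s @ q"
    using assms(1) by (auto simp: sublist_def)
  have "cmod (Phi a s \<omega>) = cmod (Phi a (p @ s) \<omega> - Phi a p \<omega>)"
    by (simp add: Phi_append norm_mult)
  also have "\<dots> \<le> cmod (Phi a (p @ s) \<omega>) + cmod (Phi a p \<omega>)"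
    by (rule norm_triangle_ineq4)
  also have "\<dots> \<le> K + K"
    using assms(2)[of "p @ s"] assms(2)[of p] by (intro add_mono) (auto simp: t)
  finally show ?thesis by simp
qed

section \<open>Powers of a substitution and windows of its sequences\<close>

lemma subst_pow_0 [simp]: "subst_pow \<zeta> 0 u = u"
  by (simp add: subst_pow_def)

lemma subst_pow_add: "subst_pow \<zeta> (m + n) u = subst_pow \<zeta> m (subst_pow \<zeta> n u)"
  by (simp add: subst_pow_def funpow_add)

lemma subst_pow_Suc_letter: "subst_pow \<zeta> (Suc n) [b] = subst_pow \<zeta> n (\<zeta> b)"
  using subst_pow_add[of \<zeta> n 1 "[b]"] by (simp add: subst_pow_def subst_word_def)

lemma subst_pow_Nil [simp]: "subst_pow \<zeta> n [] = []"
  by (induction n) (auto simp: subst_pow_def subst_word_def)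

lemma subst_pow_append: "subst_pow \<zeta> n (s @ t) = subst_pow \<zeta> n s @ subst_pow \<zeta> n t"
  by (induction n) (auto simp: subst_pow_def subst_word_def)

lemma subst_pow_Cons: "subst_pow \<zeta> n (b # t) = subst_pow \<zeta> n [b] @ subst_pow \<zeta> n t"
  using subst_pow_append[of \<zeta> n "[b]" t] by simp

text \<open>A window no longer than any block \<open>subst_pow \<zeta> n [b]\<close> meets at most
  two consecutive blocks. If it lies in one block, that block is doubled to form a pair.\<close>

lemma sublist_subst_pow_pair:
  assumes "sublist s (subst_pow \<zeta> n w)"
    and "\<And>b. length s \<le> length (subst_pow \<zeta> n [b])"
  obtains b\<^sub>1 b\<^sub>2 where "sublist s (subst_pow \<zeta> n [b\<^sub>1, b\<^sub>2])"
  using assms(1)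
proof (induction w arbitrary: thesis)
  case Nil
  then show ?case by simp
next
  case (Cons b w)
  have "sublist s (subst_pow \<zeta> n [b] @ subst_pow \<zeta> n w)"
    using Cons.prems(2) by (simp add: subst_pow_Cons[of _ _ b w])
  then consider "sublist s (subst_pow \<zeta> n [b])" | "sublist s (subst_pow \<zeta> n w)"
    | s\<^sub>1 s\<^sub>2 where "s = s\<^sub>1 @ s\<^sub>2" "suffix s\<^sub>1 (subst_pow \<zeta> n [b])" "prefix s\<^sub>2 (subst_pow \<zeta> n w)"
    unfolding sublist_append by blast
  then show ?case
  proof cases
    case 1
    then have "sublist s (subst_pow \<zeta> n [b, b])"
      by (simp add: subst_pow_Cons[of _ _ b "[b]"] sublist_append)
    then show ?thesis by (rule Cons.prems(1))
  next
    case 2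
    then show ?thesis using Cons.IH Cons.prems(1) by blast
  next
    case 3
    show ?thesis
    proof (cases w)
      case Nil
      then have "sublist s (subst_pow \<zeta> n [b])"
        using 3 by simp
      then have "sublist s (subst_pow \<zeta> n [b, b])"
        by (simp add: subst_pow_Cons[of _ _ b "[b]"] sublist_append)
      then show ?thesis by (rule Cons.prems(1))
    next
      case (Cons b' w')
      then have "prefix s\<^sub>2 (subst_pow \<zeta> n [b'] @ subst_pow \<zeta> n w')"
        using 3(3) by (simp add: subst_pow_Cons[of _ _ b' w'])
      \<comment> \<open>\<open>s\<^sub>2\<close> is no longer than one block, so it ends inside the
        first block of \<open>w\<close>.\<close>
      then have "prefix s\<^sub>2 (subst_pow \<zeta> n [b'])"
        using assms(2)[of b'] 3(1)
        by (metis le_add2 le_trans length_append prefixI prefix_length_prefix)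
      then have "sublist s (subst_pow \<zeta> n [b, b'])"
        using 3 by (auto simp: subst_pow_Cons[of _ _ b "[b']"] sublist_append)
      then show ?thesis by (rule Cons.prems(1))
    qed
  qed
qed

text \<open>Membership in \<open>subst_space\<close> leaves the power of the substitution
  uncontrolled. A long enough extension of the window forces a power \<open>M\<close> of at least
  \<open>n\<close>, from which \<open>n\<close> applications can be split off.\<close>

lemma subst_space_sublist:
  fixes \<zeta> :: "'a::finite \<Rightarrow> 'a list"
  assumes x: "x \<in> subst_space \<zeta>"
  obtains w where "sublist (map x [0..int N - 1]) (subst_pow \<zeta> n w)"
proof -
  \<comment> \<open>The finitely many block lengths below level \<open>n\<close>; \<open>K\<close>
    exceeds their sum and hence each of them.\<close>
  define R where "R = (\<lambda>(m, b). length (subst_pow \<zeta> m [b])) ` ({..<n} \<times> UNIV)"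
  define K where "K = Suc (N + \<Sum>R)"
  obtain b M where M: "sublist (map x [0..int K - 1]) (subst_pow \<zeta> M [b])"
    using x unfolding subst_space_def by blast
  have "finite R" by (simp add: R_def)
  have "n \<le> M"
  proof (rule ccontr)
    assume "\<not> n \<le> M"
    then have "length (subst_pow \<zeta> M [b]) \<in> R" by (force simp: R_def)
    then have "length (subst_pow \<zeta> M [b]) \<le> \<Sum>R"
      using \<open>finite R\<close> by (intro member_le_sum[where f = "\<lambda>x. x"]) auto
    then show False using sublist_length_le[OF M] by (simp add: K_def del: of_nat_sum)
  qed
  have "[0..int K - 1] = [0..int N - 1] @ [int N..int K - 1]"
    by (rule upto_split1) (auto simp: K_def simp del: of_nat_sum)
  then have "sublist (map x [0..int N - 1]) (map x [0..int K - 1])"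
    by (simp only: map_append sublist_append_rightI)
  also note M
  also have "subst_pow \<zeta> M [b] = subst_pow \<zeta> n (subst_pow \<zeta> (M - n) [b])"
    using \<open>n \<le> M\<close> by (simp flip: subst_pow_add)
  finally show thesis by (rule that)
qed

lemma funpow_shift: "(shift ^^ n) x = (\<lambda>k. x (k + int n))"
  by (induction n) (auto simp: shift_def add_ac)

lemma map_upto_shift: "map (\<lambda>k. x (k + d)) [i..j] = map x [i + d..j + d]" for d :: int
  by (rule nth_equalityI) (auto simp: nth_upto ac_simps)

lemma funpow_shift_in_subst_space:
  assumes "x \<in> subst_space \<zeta>"
  shows "(shift ^^ n) x \<in> subst_space \<zeta>"
  using assms by (simp add: subst_space_def funpow_shift map_upto_shift)

lemma twisted_sum_cylinder_eq_Phi: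
  assumes "x \<in> subst_space \<zeta>"
  shows "twisted_sum (indicator (cylinder \<zeta> a)) x N \<omega> = Phi a (map x [0..int N - 1]) \<omega>"
  unfolding twisted_sum_def Phi_eq_sum
proof (rule sum.cong)
  fix j assume "j \<in> {..<length (map x [0..int N - 1])}"
  then have "map x [0..int N - 1] ! j = x (int j)"
    by (simp add: nth_upto)
  then show "exp (- 2 * complex_of_real pi * \<i> * of_nat j * complex_of_real \<omega>) * indicator (cylinder \<zeta> a) ((shift ^^ j) x) =
      (if map x [0..int N - 1] ! j = a then phase \<omega> j else 0)"
    using funpow_shift_in_subst_space[OF assms, of j]
    by (simp add: cylinder_def indicator_def funpow_shift phase_def mult_ac)
qed simp

text \<open>The common factor of the products in both estimates.\<close>

definition damping :: "real \<Rightarrow> ('a \<Rightarrow> 'a list) \<Rightarrow> 'a list \<Rightarrow> real \<Rightarrow> nat \<Rightarrow> real" where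
  "damping c\<^sub>1 \<zeta> v \<omega> k = 1 - c\<^sub>1 * (dist_int (\<omega> * real (length (subst_pow \<zeta> k v))))\<^sup>2"

lemma dist_int_square_le: "(dist_int y)\<^sup>2 \<le> 1 / 4"
  using power_mono[OF dist_int_le_half dist_int_nonneg, of y 2] by (simp add: power2_eq_square)

text \<open>The lower bound 3/4 beats the growth rate \<theta> of at least 2 with room to spare; the
  upper bound allows factors to be dropped.\<close>

lemma damping_bounds:
  assumes "0 \<le> c\<^sub>1" "c\<^sub>1 \<le> 1"
  shows "3 / 4 \<le> damping c\<^sub>1 \<zeta> v \<omega> k" "damping c\<^sub>1 \<zeta> v \<omega> k \<le> 1"
proof -
  let ?d = "(dist_int (\<omega> * real (length (subst_pow \<zeta> k v))))\<^sup>2"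
  have "c\<^sub>1 * ?d \<le> 1 * (1 / 4)"
    using assms by (intro mult_mono dist_int_square_le) auto
  then show "3 / 4 \<le> damping c\<^sub>1 \<zeta> v \<omega> k" by (simp add: damping_def)
  show "damping c\<^sub>1 \<zeta> v \<omega> k \<le> 1" using assms by (simp add: damping_def)
qed

section \<open>Decay of the exponential sums\<close>

text \<open>\<open>weight_subst\<close> is the left eigenvector equation read letter by letter, so
  words can be weighed without matrices. The bounds \<open>lo\<close> and \<open>hi\<close> serve to
  compare weights with lengths.\<close>

locale weighted_subst =
  fixes \<zeta> :: "'a::finite \<Rightarrow> 'a list" and l :: "'a \<Rightarrow> real" and lo hi \<theta> :: real
  assumes lo_pos: "0 < lo" and lo: "lo \<le> l b" and hi: "l b \<le> hi" and \<theta>_pos: "0 < \<theta>"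
    and weight_subst: "sum_list (map l (\<zeta> b)) = \<theta> * l b"
begin

lemma l_pos: "0 < l b"
  using lo_pos lo by (rule less_le_trans)

lemma hi_pos: "0 < hi"
  using l_pos hi by (rule less_le_trans)

lemma lo_le_hi: "lo \<le> hi"
  using lo hi by (rule order_trans)

lemma weight_nonneg: "0 \<le> sum_list (map l u)"
  using l_pos by (auto intro!: sum_list_nonneg simp: less_imp_le)

lemma weight_subst_word: "sum_list (map l (subst_word \<zeta> u)) = \<theta> * sum_list (map l u)"
  by (induction u) (auto simp: subst_word_def weight_subst distrib_left)

lemma weight_subst_pow: "sum_list (map l (subst_pow \<zeta> n u)) = \<theta> ^ n * sum_list (map l u)"
  by (induction n) (auto simp: subst_pow_def weight_subst_word)

lemma weight_le_length: "sum_list (map l u) \<le> hi * real (length u)"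
  by (induction u) (auto simp: distrib_left intro!: add_mono hi)

lemma length_subst_pow_ge: "\<theta> ^ n * l b \<le> hi * real (length (subst_pow \<zeta> n [b]))"
  using weight_le_length[of "subst_pow \<zeta> n [b]"] by (simp add: weight_subst_pow)

text \<open>The image of \<open>c\<close> contains \<open>c\<close> twice, so its weight is at least
  twice that of \<open>c\<close>.\<close>

lemma eigenvalue_ge_2:
  assumes "sublist ((c # w) @ [c]) (\<zeta> c)"
  shows "2 \<le> \<theta>"
proof -
  obtain p q where "\<zeta> c = p @ ((c # w) @ [c]) @ q"
    using assms by (auto simp: sublist_def)
  then have "\<theta> * l c = sum_list (map l p) + sum_list (map l w) + sum_list (map l q) + 2 * l c"
    by (simp flip: weight_subst)
  then have "2 * l c \<le> \<theta> * l c"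
    using weight_nonneg[of p] weight_nonneg[of q] weight_nonneg[of w] by linarith
  then show ?thesis using l_pos[of c] by simp
qed

text \<open>Weights add under concatenation, so a bound proportional to weight passes from letters
  to words by the triangle inequality.\<close>

lemma cmod_Phi_subst_pow_le_weight:
  assumes "\<And>b. cmod (Phi a (subst_pow \<zeta> n [b]) \<omega>) \<le> D * l b"
  shows "cmod (Phi a (subst_pow \<zeta> n u) \<omega>) \<le> D * sum_list (map l u)"
proof (induction u)
  case (Cons b u)
  have "cmod (Phi a (subst_pow \<zeta> n (b # u)) \<omega>)
      \<le> cmod (Phi a (subst_pow \<zeta> n [b]) \<omega>) + cmod (Phi a (subst_pow \<zeta> n u) \<omega>)"
    unfolding subst_pow_Cons[of _ _ b u] by (rule cmod_Phi_append_le)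
  then show ?case
    using Cons assms[of b] by (simp add: distrib_left)
qed simp

text \<open>The two occurrences of \<open>c\<close> in \<open>\<zeta> b\<close> become copies of \<open>\<zeta>\<^sup>n c\<close> at distance \<open>\<bar>\<zeta>\<^sup>n v\<bar>\<close>.\<close>

lemma cmod_Phi_subst_pow_le:
  assumes v: "v = c # w" "\<And>b. sublist (v @ [c]) (\<zeta> b)"
    and c1: "0 \<le> c\<^sub>1" "c\<^sub>1 \<le> 1" "c\<^sub>1 * (\<theta> * hi) \<le> 2 * lo"
  shows "cmod (Phi a (subst_pow \<zeta> n [b]) \<omega>) \<le> (\<theta> ^ n * (\<Prod>k<n. damping c\<^sub>1 \<zeta> v \<omega> k) / lo) * l b"
proof (induction n arbitrary: b)
  case 0
  have "1 \<le> l b / lo" using lo[of b] lo_pos by simp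
  then show ?case using cmod_Phi_letter_le[of a b \<omega>] by simp
next
  case (Suc n)
  define D where "D = \<theta> ^ n * (\<Prod>k<n. damping c\<^sub>1 \<zeta> v \<omega> k) / lo"
  have "0 \<le> damping c\<^sub>1 \<zeta> v \<omega> k" for k
    using damping_bounds(1)[OF c1(1,2), of \<zeta> v \<omega> k] by linarith
  then have "D \<ge> 0"
    using \<theta>_pos lo_pos by (simp add: D_def prod_nonneg)
  let ?W = "\<lambda>u. sum_list (map l u)"
  let ?F = "\<lambda>u. Phi a (subst_pow \<zeta> n u) \<omega>"
  let ?t = "length (subst_pow \<zeta> n v)"
  let ?d = "dist_int (\<omega> * real ?t)"
  have F: "cmod (?F u) \<le> D * ?W u" for u
    using cmod_Phi_subst_pow_le_weight[OF Suc[folded D_def]] .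
  obtain p q where pq: "\<zeta> b = p @ (v @ [c]) @ q"
    using v(2)[of b] by (auto simp: sublist_def)
  \<comment> \<open>The two copies of \<open>subst_pow \<zeta> n [c]\<close> are grouped, the second
    one rotated by the length of \<open>subst_pow \<zeta> n v\<close>.\<close>
  have "?F (v @ [c]) = (1 + phase \<omega> ?t) * ?F [c] + phase \<omega> (length (subst_pow \<zeta> n [c])) * ?F w"
    by (simp add: v(1) subst_pow_Cons[of \<zeta> n c w] subst_pow_Cons[of \<zeta> n c "w @ [c]"]
        subst_pow_append Phi_append phase_add ring_distribs)
  then have "cmod (?F (v @ [c])) \<le> cmod (1 + phase \<omega> ?t) * cmod (?F [c]) + cmod (?F w)"
    by (metis norm_triangle_ineq norm_mult norm_phase mult_1)
  also have "cmod (1 + phase \<omega> ?t) \<le> 2 - 2 * ?d\<^sup>2"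
    using cmod_one_plus_exp_le[of "\<omega> * real ?t"] by (simp add: phase_def mult.assoc)
  also have "(2 - 2 * ?d\<^sup>2) * cmod (?F [c]) \<le> (2 - 2 * ?d\<^sup>2) * (D * l c)"
    using F[of "[c]"] dist_int_square_le[of "\<omega> * real ?t"] by (intro mult_left_mono) auto
  finally have vc: "cmod (?F (v @ [c])) \<le> (2 - 2 * ?d\<^sup>2) * (D * l c) + D * ?W w"
    using F[of w] by (simp add: mult_right_mono)
  have "cmod (?F (\<zeta> b)) \<le> cmod (?F p) + cmod (?F (v @ [c])) + cmod (?F q)"
    using cmod_Phi_append_le[of a "subst_pow \<zeta> n p" "subst_pow \<zeta> n (v @ [c]) @ subst_pow \<zeta> n q" \<omega>]
      cmod_Phi_append_le[of a "subst_pow \<zeta> n (v @ [c])" "subst_pow \<zeta> n q" \<omega>]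
    unfolding pq subst_pow_append[of _ _ p] subst_pow_append[of _ _ "v @ [c]" q] by linarith
  also have "\<dots> \<le> D * ?W p + ((2 - 2 * ?d\<^sup>2) * (D * l c) + D * ?W w) + D * ?W q"
    using vc F by (intro add_mono)
  also have "\<dots> = D * (?W (\<zeta> b) - 2 * ?d\<^sup>2 * l c)"
    by (simp add: pq v(1) algebra_simps)
  also have "\<dots> \<le> D * (\<theta> * l b * damping c\<^sub>1 \<zeta> v \<omega> n)"
  proof -
    \<comment> \<open>The smallness of \<open>c\<^sub>1\<close> enters here: the loss at the single
      letter \<open>c\<close> amounts to a fraction \<open>c\<^sub>1 * ?d\<^sup>2\<close> of the
      whole weight of \<open>\<zeta> b\<close>.\<close>
    have "c\<^sub>1 * (\<theta> * l b) \<le> c\<^sub>1 * (\<theta> * hi)"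
      using c1(1) \<theta>_pos hi[of b] by (intro mult_left_mono) auto
    also have "\<dots> \<le> 2 * l c" using c1(3) lo[of c] by linarith
    finally have "?d\<^sup>2 * (c\<^sub>1 * (\<theta> * l b)) \<le> ?d\<^sup>2 * (2 * l c)"
      by (rule mult_left_mono) simp
    then show ?thesis
      using \<open>D \<ge> 0\<close>
      by (intro mult_left_mono) (simp_all add: weight_subst damping_def algebra_simps)
  qed
  finally show ?case
    by (simp add: subst_pow_Suc_letter D_def mult_ac)
qed

section \<open>From blocks to prefixes and windows\<close>

context
  fixes a :: 'a and \<omega> :: real and G :: "nat \<Rightarrow> real" and L :: real
  assumes G: "\<And>n b. cmod (Phi a (subst_pow \<zeta> n [b]) \<omega>) \<le> G n"
    and G0: "1 \<le> G 0" and G_Suc: "\<And>n. 3 / 2 * G n \<le> G (Suc n)"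
    and L: "\<And>b. real (length (\<zeta> b)) \<le> L" "1 \<le> L"
begin

lemma G_nonneg: "0 \<le> G n"
  using G[of n undefined] by (rule order_trans[OF norm_ge_zero])

text \<open>A prefix consists of complete blocks, each costing at most \<open>G n\<close>, and at
  most one incomplete block, costing \<open>K\<close>.\<close>

lemma cmod_Phi_prefix_word_le:
  assumes "\<And>b u. prefix u (subst_pow \<zeta> n [b]) \<Longrightarrow> cmod (Phi a u \<omega>) \<le> K"
    and "prefix u (subst_pow \<zeta> n w)" and "0 \<le> K"
  shows "cmod (Phi a u \<omega>) \<le> real (length w) * G n + K"
  using assms(2)
proof (induction w arbitrary: u)
  case Nil
  then show ?case using assms(3) by simp
next
  case (Cons b w)
  then have "prefix u (subst_pow \<zeta> n [b] @ subst_pow \<zeta> n w)"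
    by (simp add: subst_pow_Cons[of _ _ b w])
  then consider "prefix u (subst_pow \<zeta> n [b])"
    | u' where "u = subst_pow \<zeta> n [b] @ u'" "prefix u' (subst_pow \<zeta> n w)"
    by (auto simp: prefix_append)
  then show ?case
  proof cases
    case 1
    then show ?thesis
      using assms(1)[OF 1] G_nonneg[of n] by (simp add: add_increasing)
  next
    case 2
    have "cmod (Phi a u \<omega>) \<le> cmod (Phi a (subst_pow \<zeta> n [b]) \<omega>) + cmod (Phi a u' \<omega>)"
      unfolding 2(1) by (rule cmod_Phi_append_le)
    then show ?thesis
      using Cons.IH[OF 2(2)] G[of n b] by (simp add: distrib_right)
  qed
qed

text \<open>Summing over the levels of the prefix decomposition gives a geometric series with ratio at
  least \<open>3/2\<close>, so the top level dominates.\<close>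

lemma cmod_Phi_prefix_le:
  assumes "prefix u (subst_pow \<zeta> n [b])"
  shows "cmod (Phi a u \<omega>) \<le> 2 * L * G n"
  using assms
proof (induction n arbitrary: u b)
  case 0
  then have "u = [] \<or> u = [b]" by (auto simp: prefix_Cons)
  then have "cmod (Phi a u \<omega>) \<le> 1" by (auto simp: cmod_Phi_letter_le)
  also have "1 \<le> 2 * L * G 0"
    using L(2) G0 mult_mono[of 1 "2 * L" 1 "G 0"] by simp
  finally show ?case .
next
  case (Suc n)
  have "0 \<le> 2 * L * G n" using L(2) G_nonneg[of n] by simp
  then have "cmod (Phi a u \<omega>) \<le> real (length (\<zeta> b)) * G n + 2 * L * G n"
    using Suc by (intro cmod_Phi_prefix_word_le) (auto simp: subst_pow_Suc_letter)
  also have "\<dots> \<le> L * G n + 2 * L * G n"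
    using L(1)[of b] G_nonneg[of n] by (simp add: mult_right_mono)
  \<comment> \<open>The constant \<open>2 * L\<close> solves \<open>L + K = 3/2 * K\<close>, which
    closes the induction.\<close>
  also have "\<dots> = 2 * L * (3 / 2 * G n)" by simp
  also have "\<dots> \<le> 2 * L * G (Suc n)"
    using L(2) G_Suc[of n] by (intro mult_left_mono) auto
  finally show ?case .
qed

text \<open>The window lies in two blocks, where prefixes cost at most
  \<open>2 * G n + 2 * L * G n\<close>; taking the difference of two prefixes doubles this.\<close>

lemma cmod_Phi_subst_space_le:
  assumes "x \<in> subst_space \<zeta>" and "\<And>b. N \<le> length (subst_pow \<zeta> n [b])"
  shows "cmod (Phi a (map x [0..int N - 1]) \<omega>) \<le> 4 * (1 + L) * G n"
proof -
  let ?s = "map x [0..int N - 1]"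
  obtain w where "sublist ?s (subst_pow \<zeta> n w)"
    using subst_space_sublist[OF assms(1)] .
  then obtain b\<^sub>1 b\<^sub>2 where b: "sublist ?s (subst_pow \<zeta> n [b\<^sub>1, b\<^sub>2])"
    using assms(2) by (auto intro: sublist_subst_pow_pair)
  have "0 \<le> 2 * L * G n" using L(2) G_nonneg[of n] by simp
  then have "cmod (Phi a u \<omega>) \<le> real (length [b\<^sub>1, b\<^sub>2]) * G n + 2 * L * G n"
    if "prefix u (subst_pow \<zeta> n [b\<^sub>1, b\<^sub>2])" for u
    using that cmod_Phi_prefix_le by (intro cmod_Phi_prefix_word_le)
  from cmod_Phi_sublist_le[OF b this] show ?thesis
    by (simp add: algebra_simps)
qed

end

text \<open>Estimate (i): the weight \<open>\<theta> ^ n * l b\<close> of a block is at most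
  \<open>hi\<close> times its length.\<close>

lemma cmod_Phi_subst_pow_le_length:
  assumes v: "v = c # w" "\<And>b. sublist (v @ [c]) (\<zeta> b)"
    and c1: "0 \<le> c\<^sub>1" "c\<^sub>1 \<le> 1" "c\<^sub>1 * (\<theta> * hi) \<le> 2 * lo"
  shows "cmod (Phi a (subst_pow \<zeta> n [b]) \<omega>)
    \<le> hi / lo * real (length (subst_pow \<zeta> n [b])) * (\<Prod>k<n. damping c\<^sub>1 \<zeta> v \<omega> k)"
proof -
  let ?P = "\<Prod>k<n. damping c\<^sub>1 \<zeta> v \<omega> k"
  have "0 \<le> damping c\<^sub>1 \<zeta> v \<omega> k" for k
    using damping_bounds(1)[OF c1(1,2), of \<zeta> v \<omega> k] by linarith
  then have "0 \<le> ?P / lo"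
    using lo_pos by (simp add: prod_nonneg)
  then have "?P / lo * (\<theta> ^ n * l b) \<le> ?P / lo * (hi * real (length (subst_pow \<zeta> n [b])))"
    using length_subst_pow_ge by (intro mult_left_mono)
  then show ?thesis
    using cmod_Phi_subst_pow_le[OF assms, of a n b \<omega>] by (simp add: mult_ac)
qed

text \<open>Estimate (ii) with 1 in the role of \<open>C\<^sub>2\<close>. One factor
  \<open>hi / lo\<close> comes from the block bound \<open>G\<close>; the other, together with
  \<theta>, comes from rounding up to a level whose blocks have length at least
  \<open>N\<close>.\<close>

lemma cmod_Phi_subst_space_le_prod:
  assumes v: "v = c # w" "\<And>b. sublist (v @ [c]) (\<zeta> b)"
    and c1: "0 \<le> c\<^sub>1" "c\<^sub>1 \<le> 1" "c\<^sub>1 * (\<theta> * hi) \<le> 2 * lo"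
    and L: "\<And>b. real (length (\<zeta> b)) \<le> L" "1 \<le> L"
    and x: "x \<in> subst_space \<zeta>"
  shows "cmod (Phi a (map x [0..int N - 1]) \<omega>) \<le> 4 * (1 + L) * (hi / lo) ^ 2 * \<theta> * real N *
    (\<Prod>k | int k \<le> \<lfloor>log \<theta> (real N) - 1\<rfloor>. damping c\<^sub>1 \<zeta> v \<omega> k)"
proof (cases "N = 0")
  case False
  have damp: "0 \<le> damping c\<^sub>1 \<zeta> v \<omega> k" "3 / 4 \<le> damping c\<^sub>1 \<zeta> v \<omega> k" "damping c\<^sub>1 \<zeta> v \<omega> k \<le> 1" for k
    using damping_bounds[OF c1(1,2), of \<zeta> v \<omega> k] by linarith+
  have \<theta>: "2 \<le> \<theta>"
    using v(2)[of c] unfolding v(1) by (rule eigenvalue_ge_2)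
  define r where "r = hi / lo"
  have r: "1 \<le> r" using lo_le_hi lo_pos by (simp add: r_def)
  define P where "P = (\<lambda>n. \<Prod>k<n. damping c\<^sub>1 \<zeta> v \<omega> k)"
  have P_nonneg: "0 \<le> P n" for n
    using damp by (simp add: P_def prod_nonneg)
  \<comment> \<open>The factor \<open>r\<close> makes the bound uniform in the letter and gives
    \<open>G 0\<close> at least 1.\<close>
  define G where "G = (\<lambda>n. \<theta> ^ n * P n * r)"
  have G: "cmod (Phi a (subst_pow \<zeta> n [b]) \<omega>) \<le> G n" for n b
  proof -
    have "\<theta> ^ n * P n / lo * l b \<le> \<theta> ^ n * P n / lo * hi"
      using hi[of b] P_nonneg[of n] \<theta>_pos lo_pos by (intro mult_left_mono) auto
    then show ?thesis
      using cmod_Phi_subst_pow_le[OF v c1, of a n b \<omega>] by (simp add: G_def P_def r_def)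
  qed
  have "1 \<le> G 0" using r by (simp add: G_def P_def)
  moreover have "3 / 2 * G n \<le> G (Suc n)" for n
  proof -
    have "2 * (3 / 4) \<le> \<theta> * damping c\<^sub>1 \<zeta> v \<omega> n"
      using \<theta> damp by (intro mult_mono) auto
    then have "3 / 2 * G n \<le> (\<theta> * damping c\<^sub>1 \<zeta> v \<omega> n) * G n"
      using G[of n undefined] by (intro mult_right_mono) (auto intro: order_trans[OF norm_ge_zero])
    then show ?thesis by (simp add: G_def P_def mult_ac)
  qed
  \<comment> \<open>The first level with \<open>\<theta> ^ n\<close> at least \<open>N * r\<close>:
    its blocks are long enough, and \<open>\<theta> ^ n\<close> overshoots by at most one factor
    \<theta>.\<close>
  moreover define n where "n = nat \<lceil>log \<theta> (real N * r)\<rceil>"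
  have Nr: "1 \<le> real N * r"
    using False r mult_mono[of 1 "real N" 1 r] by simp
  then have log_nonneg: "0 \<le> log \<theta> (real N * r)"
    using \<theta> by (simp add: zero_le_log_cancel_iff)
  then have n: "log \<theta> (real N * r) \<le> real n" "real n \<le> log \<theta> (real N * r) + 1"
    unfolding n_def by linarith+
  have pow_ge: "real N * r \<le> \<theta> ^ n"
    using n(1) \<theta> Nr by (simp add: log_le_iff powr_realpow)
  have "\<theta> powr real n \<le> \<theta> powr (log \<theta> (real N * r) + 1)"
    using n(2) \<theta> by (intro powr_mono) auto
  then have pow_le: "\<theta> ^ n \<le> \<theta> * (real N * r)"
    using \<theta> Nr by (simp add: powr_realpow powr_add mult.commute)
  have "N \<le> length (subst_pow \<zeta> n [b])" for b
  proof -
    have "real N * hi \<le> \<theta> ^ n * lo"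
      using pow_ge lo_pos by (simp add: r_def field_simps)
    also have "\<dots> \<le> \<theta> ^ n * l b"
      using lo[of b] \<theta>_pos by (intro mult_left_mono) auto
    also have "\<dots> \<le> real (length (subst_pow \<zeta> n [b])) * hi"
      using length_subst_pow_ge[of n b] by (simp add: mult.commute)
    finally show ?thesis using hi_pos by simp
  qed
  ultimately have "cmod (Phi a (map x [0..int N - 1]) \<omega>) \<le> 4 * (1 + L) * G n"
    using cmod_Phi_subst_space_le[of a \<omega> G L x N n] G L x by blast
  also have "\<dots> \<le> 4 * (1 + L) * (\<theta> * (real N * r) * P n * r)"
    unfolding G_def using pow_le P_nonneg[of n] r L(2)
    by (intro mult_left_mono mult_right_mono) auto
  also have "\<dots> = 4 * (1 + L) * r ^ 2 * \<theta> * real N * P n"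
    by (simp add: power2_eq_square mult_ac)
  also have "\<dots> \<le> 4 * (1 + L) * r ^ 2 * \<theta> * real N *
      (\<Prod>k | int k \<le> \<lfloor>log \<theta> (real N) - 1\<rfloor>. damping c\<^sub>1 \<zeta> v \<omega> k)"
  proof (rule mult_left_mono)
    let ?A = "{k. int k \<le> \<lfloor>log \<theta> (real N) - 1\<rfloor>}"
    have "log \<theta> (real N) \<le> log \<theta> (real N * r)"
      using \<theta> False r by (subst log_le_cancel_iff) auto
    then have "real k < real n" if "k \<in> ?A" for k
      using that n(1) by (simp only: mem_Collect_eq le_floor_iff)
    \<comment> \<open>All indices of the claimed product lie below \<open>n\<close>, and the surplus
      factors of \<open>P n\<close> are at most 1.\<close>
    then have "?A \<subseteq> {..<n}" by auto
    then have "P n = (\<Prod>k\<in>{..<n} - ?A. damping c\<^sub>1 \<zeta> v \<omega> k) * (\<Prod>k\<in>?A. damping c\<^sub>1 \<zeta> v \<omega> k)"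
      unfolding P_def by (intro prod.subset_diff) auto
    also have "\<dots> \<le> 1 * (\<Prod>k\<in>?A. damping c\<^sub>1 \<zeta> v \<omega> k)"
      using damp by (intro mult_right_mono prod_le_1 prod_nonneg) auto
    finally show "P n \<le> (\<Prod>k\<in>?A. damping c\<^sub>1 \<zeta> v \<omega> k)" by simp
  qed (use L(2) \<theta> in auto)
  finally show ?thesis by (simp add: r_def)
qed simp

end

section \<open>Perron weights of a primitive substitution and the final constants\<close>

lemma primitive_subst_weights:
  fixes \<zeta> :: "'a::finite \<Rightarrow> 'a list"
  assumes "primitive_subst \<zeta>"
  obtains l lo hi where "weighted_subst \<zeta> l lo hi (pf_eigenvalue (subst_matrix \<zeta>))"
proof -
  let ?A = "subst_matrix \<zeta>"
  obtain k where k: "k \<ge> 1" "\<And>i j. 0 < mat_pow ?A k $ i $ j"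
    using assms by (auto simp: primitive_subst_def)
  have "0 \<le> ?A $ i $ j" for i j by (simp add: subst_matrix_def)
  then obtain l \<theta> where l: "\<theta> > 0" "\<And>i. l $ i > 0" "l v* ?A = \<theta> *\<^sub>R l"
    using exists_pos_left_eigenvector[of ?A k] k by metis
  have \<theta>: "pf_eigenvalue ?A = \<theta>"
    using k(2) l(2,3,1) by (rule pf_eigenvalue_eqI)
  \<comment> \<open>Column \<open>b\<close> of the matrix counts the letters of
    \<open>\<zeta> b\<close>, so the eigenvector equation at \<open>b\<close> is a statement about
    the weight of \<open>\<zeta> b\<close>.\<close>
  have count: "sum_list (map (($) l) u) = (\<Sum>i\<in>UNIV. real (count_list u i) * l $ i)" for u
  proof (induction u)
    case (Cons b u)
    have "(\<Sum>i\<in>UNIV. real (count_list (b # u) i) * l $ i)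
        = (\<Sum>i\<in>UNIV. real (count_list u i) * l $ i + (if i = b then l $ i else 0))"
      by (intro sum.cong) (auto simp: distrib_right)
    then show ?case
      using Cons by (simp add: sum.distrib)
  qed simp
  have "sum_list (map (($) l) (\<zeta> b)) = \<theta> * l $ b" for b
    using count[of "\<zeta> b"] l(3)
    by (simp add: vec_eq_iff vector_matrix_mult_def subst_matrix_def mult.commute)
  then have "weighted_subst \<zeta> (($) l) (Min (range (($) l))) (Max (range (($) l))) \<theta>"
    using l(1,2) by unfold_locales auto
  then show thesis using that \<theta> by metis
qed

theorem proposition3p5:
  fixes \<zeta> :: "'a::finite \<Rightarrow> 'a list"
  assumes "CARD('a) \<ge> 2"
    and "substitution \<zeta>"
    and "primitive_subst \<zeta>"
    and "aperiodic_subst \<zeta>"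
  shows "\<exists>c\<^sub>1 C' C'' C\<^sub>2 :: real. 0 < c\<^sub>1 \<and> c\<^sub>1 < 1 \<and> C' > 0 \<and> C'' > 0 \<and> C\<^sub>2 > 0 \<and>
    (\<forall>c v. return_word \<zeta> c v \<and> (\<forall>b. sublist (v @ [c]) (\<zeta> b)) \<longrightarrow>
      (\<forall>a b n. \<forall>\<omega>\<in>{0..<1}.
         cmod (Phi a (subst_pow \<zeta> n [b]) \<omega>)
           \<le> C' * real (length (subst_pow \<zeta> n [b])) *
             (\<Prod>k<n. 1 - c\<^sub>1 * (dist_int (\<omega> * real (length (subst_pow \<zeta> k v))))\<^sup>2)) \<and>
      (\<forall>N a. \<forall>\<omega>\<in>{0..<1}. \<forall>x\<in>subst_space \<zeta>.
         cmod (twisted_sum (indicator (cylinder \<zeta> a)) x N \<omega>)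
           \<le> C'' * real N *
             (\<Prod>k | int k \<le> \<lfloor>log (pf_eigenvalue (subst_matrix \<zeta>)) (real N) - C\<^sub>2\<rfloor>.
                1 - c\<^sub>1 * (dist_int (\<omega> * real (length (subst_pow \<zeta> k v))))\<^sup>2)))"
proof -
  let ?\<theta> = "pf_eigenvalue (subst_matrix \<zeta>)"
  obtain l lo hi where "weighted_subst \<zeta> l lo hi ?\<theta>"
    using primitive_subst_weights[OF assms(3)] .
  then interpret weighted_subst \<zeta> l lo hi ?\<theta> .
  \<comment> \<open>The bound 1/2 keeps \<open>c\<^sub>1\<close> below 1; the other term is what the
    loss estimate requires.\<close>
  define c\<^sub>1 where "c\<^sub>1 = min (1 / 2) (2 * lo / (?\<theta> * hi))"
  have c1_pos: "0 < c\<^sub>1"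
    using lo_pos hi_pos \<theta>_pos by (simp add: c\<^sub>1_def)
  have "c\<^sub>1 * (?\<theta> * hi) \<le> 2 * lo / (?\<theta> * hi) * (?\<theta> * hi)"
    using hi_pos \<theta>_pos by (intro mult_right_mono) (auto simp: c\<^sub>1_def)
  then have c1: "0 \<le> c\<^sub>1" "c\<^sub>1 \<le> 1" "c\<^sub>1 * (?\<theta> * hi) \<le> 2 * lo"
    using c1_pos hi_pos \<theta>_pos by (auto simp: c\<^sub>1_def)
  define L where "L = 1 + real (\<Sum>b\<in>UNIV. length (\<zeta> b))"
  have L: "real (length (\<zeta> b)) \<le> L" for b
    unfolding L_def using member_le_sum[of b UNIV "\<lambda>b. length (\<zeta> b)"]
    by (simp flip: of_nat_sum add: of_nat_le_iff le_Suc_eq)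
  have L1: "1 \<le> L" by (simp add: L_def sum_nonneg)
  \<comment> \<open>All constants are fixed before \<open>c\<close> and \<open>v\<close> are
    introduced, hence depend only on the substitution.\<close>
  show ?thesis
  proof (rule exI[of _ c\<^sub>1], rule exI[of _ "hi / lo"],
      rule exI[of _ "4 * (1 + L) * (hi / lo)\<^sup>2 * ?\<theta>"], rule exI[of _ 1],
      intro conjI allI impI ballI)
    show "0 < c\<^sub>1" "c\<^sub>1 < 1" using c1_pos by (auto simp: c\<^sub>1_def)
    show "0 < hi / lo" using hi_pos lo_pos by simp
    show "0 < 4 * (1 + L) * (hi / lo)\<^sup>2 * ?\<theta>" using hi_pos lo_pos \<theta>_pos L1 by simp
  next
    fix c v a b n and \<omega> :: real
    assume cv: "return_word \<zeta> c v \<and> (\<forall>b. sublist (v @ [c]) (\<zeta> b))"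
    obtain w where v: "v = c # w" using cv by (auto simp: return_word_def)
    have sub: "sublist (v @ [c]) (\<zeta> b)" for b using cv by blast
    show "cmod (Phi a (subst_pow \<zeta> n [b]) \<omega>) \<le> hi / lo * real (length (subst_pow \<zeta> n [b])) *
        (\<Prod>k<n. 1 - c\<^sub>1 * (dist_int (\<omega> * real (length (subst_pow \<zeta> k v))))\<^sup>2)"
      using cmod_Phi_subst_pow_le_length[OF v sub c1] by (simp add: damping_def)
  next
    fix c v N a x and \<omega> :: real
    assume cv: "return_word \<zeta> c v \<and> (\<forall>b. sublist (v @ [c]) (\<zeta> b))"
      and x: "x \<in> subst_space \<zeta>"
    obtain w where v: "v = c # w" using cv by (auto simp: return_word_def)
    have sub: "sublist (v @ [c]) (\<zeta> b)" for b using cv by blast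
    show "cmod (twisted_sum (indicator (cylinder \<zeta> a)) x N \<omega>)
        \<le> 4 * (1 + L) * (hi / lo)\<^sup>2 * ?\<theta> * real N *
          (\<Prod>k | int k \<le> \<lfloor>log ?\<theta> (real N) - 1\<rfloor>.
            1 - c\<^sub>1 * (dist_int (\<omega> * real (length (subst_pow \<zeta> k v))))\<^sup>2)"
      unfolding twisted_sum_cylinder_eq_Phi[OF x]
      using cmod_Phi_subst_space_le_prod[OF v sub c1 L L1 x] by (simp add: damping_def)
  qed simp
qed

end
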